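(* For any task representable as a deterministic context-free language (DCFL), there always exists a counting reward automaton (CRA) which encodes it and incurs a blowup of $O\left(|\Gamma|^{nm(e+1)}\right)$ in the size of the CRA policy. Here $n$ is the length of the episodes, and $\Gamma$, $m$, $e$ are parameters of a deterministic pushdown automaton (DPDA) recognising the language: $\Gamma$ is its stack alphabet, $m$ is the maximum number of symbols that can be added to the stack at any of its transitions, and $e$ is the maximum number of $\epsilon$-transitions pushing symbols to the stack in a single $\epsilon$-sequence.
   Context: In a DPDA, each transition depends on the current state, on the next input symbol (or on no input, in which case it is an $\epsilon$-transition) and on the topmost stack symbol, which it replaces by a (possibly empty) string over the stack alphabet $\Gamma$. An $\epsilon$-sequence is a sequence of $\epsilon$-transitions which are taken before the automaton must read a symbol to advance. A DCFL is a language recognised by some DPDA. A counter machine is a finite automaton augmented with a fixed number of counters that may be incremented, decremented and tested for zero. A CRA is an automaton based on a counter machine which outputs rewards and is used to encode a (non-Markovian) reward function for reinforcement learning in a Markov decision process; the reward functions (tasks) it can encode correspond to the languages accepted by its underlying counter machine. Tasks are episodic, of length $n$, so the automaton reads input words of length $n$. A CRA policy is a policy trained with access to a CRA: at each timestep it has access to the values stored in all counters. Its size is the size of the table representing it. The blowup in the size of the CRA policy is measured by the number of possible combinations of counter values (counter configurations).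
   Formalization: The blowup bound is stated only when the maximum e exists and |Γ| ≥ 2; for |Γ| = 1 the bound O(1) is false, e.g. for {a^i b^j : j ≤ i+1}, which is nonregular but has a one-stack-symbol DPDA. Existence of the CRA is stated for every DPDA. *)

theory Defs
  imports Complex_Main "HOL-Library.Cardinality" "HOL-Library.Landau_Symbols"
begin

section \<open>Runs of deterministic devices with \<open>\<epsilon>\<close>-transitions\<close>

text \<open>
  A device is given by its (partial) one-step function on configurations; the label \<open>None\<close>
  stands for an \<open>\<epsilon>\<close>-transition and \<open>Some a\<close> for a transition reading \<open>a\<close>.  In
  \<open>run step wt c w r c'\<close> the word \<open>w\<close> is the input consumed and \<open>r\<close> is the sum of
  the weights of the transitions taken.
\<close>

inductive run ::
  "('c \<Rightarrow> 'a option \<Rightarrow> 'c option) \<Rightarrow> ('c \<Rightarrow> 'a option \<Rightarrow> 'r::monoid_add)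
    \<Rightarrow> 'c \<Rightarrow> 'a list \<Rightarrow> 'r \<Rightarrow> 'c \<Rightarrow> bool"
  for step wt where
  run_refl: "run step wt c [] 0 c"
| run_eps:  "step c None = Some c' \<Longrightarrow> run step wt c' w r c''
              \<Longrightarrow> run step wt c w (wt c None + r) c''"
| run_read: "step c (Some a) = Some c' \<Longrightarrow> run step wt c' w r c''
              \<Longrightarrow> run step wt c (a # w) (wt c (Some a) + r) c''"

definition reaches :: "('c \<Rightarrow> 'a option \<Rightarrow> 'c option) \<Rightarrow> 'c \<Rightarrow> 'a list \<Rightarrow> 'c \<Rightarrow> bool" where
  "reaches step c w c' \<longleftrightarrow> run step (\<lambda>_ _. 0::nat) c w 0 c'"

text \<open>The \<open>\<epsilon>\<close>-sequence is over: a symbol must be read to advance.\<close>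

definition settled :: "('c \<Rightarrow> 'a option \<Rightarrow> 'c option) \<Rightarrow> 'c \<Rightarrow> bool" where
  "settled step c \<longleftrightarrow> step c None = None"


section \<open>Deterministic pushdown automata\<close>

text \<open>
  States, input alphabet and stack alphabet are the finite types \<open>'q\<close>, \<open>'a\<close>, \<open>'g\<close>.
  The head of a stack is its topmost symbol; acceptance is by final state, possibly
  in the middle of the \<open>\<epsilon>\<close>-sequence following the last symbol.
\<close>

record ('q, 'a, 'g) dpda =
  pda_init  :: 'q
  pda_bot   :: 'g
  pda_final :: "'q set"
  pda_trans :: "'q \<Rightarrow> 'a option \<Rightarrow> 'g \<Rightarrow> ('q \<times> 'g list) option"

definition is_dpda :: "('q::finite, 'a::finite, 'g::finite) dpda \<Rightarrow> bool" where
  "is_dpda M \<longleftrightarrow>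
    (\<forall>q X. pda_trans M q None X \<noteq> None \<longrightarrow> (\<forall>a. pda_trans M q (Some a) X = None))"

fun pda_step ::
  "('q, 'a, 'g) dpda \<Rightarrow> 'q \<times> 'g list \<Rightarrow> 'a option \<Rightarrow> ('q \<times> 'g list) option" where
  "pda_step M (q, []) x = None"
| "pda_step M (q, X # \<gamma>) x = map_option (\<lambda>(p, \<alpha>). (p, \<alpha> @ \<gamma>)) (pda_trans M q x X)"

definition pda_start :: "('q, 'a, 'g) dpda \<Rightarrow> 'q \<times> 'g list" where
  "pda_start M = (pda_init M, [pda_bot M])"

definition pda_language :: "('q, 'a, 'g) dpda \<Rightarrow> 'a list set" where
  "pda_language M =
    {w. \<exists>q \<gamma>. reaches (pda_step M) (pda_start M) w (q, \<gamma>) \<and> q \<in> pda_final M}"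

text \<open>
  Replacing the topmost symbol \<open>X\<close> by \<open>\<alpha>\<close> adds \<open>length \<alpha> - 1\<close> symbols to the stack
  (truncated subtraction: popping adds none).  Counting \<open>length \<alpha>\<close> instead would only
  increase the two parameters below.  For a DPDA without transitions the first one is 0,
  as \<open>Sup {} = 0\<close> on \<open>nat\<close>.
\<close>

definition max_added :: "('q, 'a, 'g) dpda \<Rightarrow> nat" where
  "max_added M = Sup {length \<alpha> - 1 | q x X p \<alpha>. pda_trans M q x X = Some (p, \<alpha>)}"

fun pushing :: "('q, 'a, 'g) dpda \<Rightarrow> 'q \<times> 'g list \<Rightarrow> 'a option \<Rightarrow> nat" where
  "pushing M (q, []) x = 0"
| "pushing M (q, X # \<gamma>) x =
    (case pda_trans M q x X of None \<Rightarrow> 0 | Some (p, \<alpha>) \<Rightarrow> if length \<alpha> - 1 > 0 then 1 else 0)"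

text \<open>
  The numbers of pushing transitions in the \<open>\<epsilon>\<close>-sequences occurring in computations of \<open>M\<close>.
  The maximum exists iff this set is finite.
\<close>

definition eps_push_counts :: "('q, 'a, 'g) dpda \<Rightarrow> nat set" where
  "eps_push_counts M =
    {k. \<exists>w c c'. reaches (pda_step M) (pda_start M) w c \<and> run (pda_step M) (pushing M) c [] k c'}"


section \<open>Counter machines\<close>

text \<open>
  A transition may depend on which counters are zero (\<open>True\<close> in the list of zero tests).
\<close>

datatype counter_op = Incr | Decr | Keep

fun apply_op :: "counter_op \<Rightarrow> nat \<Rightarrow> nat" where
  "apply_op Incr c = c + 1"
| "apply_op Decr c = c - 1"
| "apply_op Keep c = c"

record ('q, 'a) counter_machine =
  cm_states   :: "'q set"
  cm_counters :: nat
  cm_init     :: 'q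
  cm_final    :: "'q set"
  cm_trans    :: "'q \<Rightarrow> 'a option \<Rightarrow> bool list \<Rightarrow> ('q \<times> counter_op list) option"

definition is_counter_machine :: "('q, 'a, 'z) counter_machine_scheme \<Rightarrow> bool" where
  "is_counter_machine A \<longleftrightarrow>
    finite (cm_states A) \<and> cm_init A \<in> cm_states A \<and> cm_final A \<subseteq> cm_states A \<and>
    (\<forall>q\<in>cm_states A. \<forall>z. length z = cm_counters A \<longrightarrow>
      (\<forall>x q' us. cm_trans A q x z = Some (q', us) \<longrightarrow>
        q' \<in> cm_states A \<and> length us = cm_counters A \<and>
        (\<forall>i<cm_counters A. us ! i = Decr \<longrightarrow> \<not> z ! i)) \<and>
      (cm_trans A q None z \<noteq> None \<longrightarrow> (\<forall>a. cm_trans A q (Some a) z = None)))"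

definition zero_tests :: "nat list \<Rightarrow> bool list" where
  "zero_tests cs = map (\<lambda>c. c = 0) cs"

fun cm_step ::
  "('q, 'a, 'z) counter_machine_scheme \<Rightarrow> 'q \<times> nat list \<Rightarrow> 'a option
    \<Rightarrow> ('q \<times> nat list) option" where
  "cm_step A (q, cs) x =
    map_option (\<lambda>(q', us). (q', map2 apply_op us cs)) (cm_trans A q x (zero_tests cs))"

definition cm_start :: "('q, 'a, 'z) counter_machine_scheme \<Rightarrow> 'q \<times> nat list" where
  "cm_start A = (cm_init A, replicate (cm_counters A) 0)"

definition cm_language :: "('q, 'a, 'z) counter_machine_scheme \<Rightarrow> 'a list set" where
  "cm_language A =
    {w. \<exists>q cs. reaches (cm_step A) (cm_start A) w (q, cs) \<and> q \<in> cm_final A}"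


section \<open>Counting reward automata\<close>

text \<open>Every transition, \<open>\<epsilon>\<close>-transitions included, outputs a reward.\<close>

record ('q, 'a) cra = "('q, 'a) counter_machine" +
  cra_reward :: "'q \<Rightarrow> 'a option \<Rightarrow> bool list \<Rightarrow> real"

fun reward_output :: "('q, 'a) cra \<Rightarrow> 'q \<times> nat list \<Rightarrow> 'a option \<Rightarrow> real" where
  "reward_output A (q, cs) x = cra_reward A q x (zero_tests cs)"

text \<open>
  The configuration present at the timestep at which the word \<open>w\<close> has been read and the
  \<open>\<epsilon>\<close>-sequence following it has been completed.
\<close>

definition timestep :: "('q, 'a, 'z) counter_machine_scheme \<Rightarrow> 'a list \<Rightarrow> 'q \<times> nat list \<Rightarrow> bool" where
  "timestep A w c \<longleftrightarrow> reaches (cm_step A) (cm_start A) w c \<and> settled (cm_step A) c"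

text \<open>
  The task given by a language \<open>L\<close> rewards a timestep with 1 if the history up to it is in
  \<open>L\<close> and with 0 otherwise.  A CRA encoding it accepts \<open>L\<close>, processes every history without
  getting stuck, and outputs these rewards, the reward of a timestep being the total output of
  the transition reading the symbol and of the \<open>\<epsilon>\<close>-sequence following it.
\<close>

definition encodes :: "('q, 'a) cra \<Rightarrow> 'a list set \<Rightarrow> bool" where
  "encodes A L \<longleftrightarrow>
    cm_language A = L \<and>
    (\<forall>w. \<exists>c. timestep A w c) \<and>
    (\<forall>w a c c' r. timestep A w c \<and> run (cm_step A) (reward_output A) c [a] r c' \<and>
        settled (cm_step A) c' \<longrightarrow> r = (if w @ [a] \<in> L then 1 else 0))"

text \<open>
  The combinations of counter values a policy can be confronted with in episodes of length
  \<open>n\<close>.  This set is finite for every counter machine, as there are finitely many words of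
  length at most \<open>n\<close> over the finite type \<open>'a\<close> and each determines one configuration.
\<close>

definition counter_configs ::
  "('q, 'a::finite, 'z) counter_machine_scheme \<Rightarrow> nat \<Rightarrow> nat list set" where
  "counter_configs A n = {cs. \<exists>w q. length w \<le> n \<and> timestep A w (q, cs)}"

end

theory Submission
  imports Defs "HOL-Library.Countable_Set"
begin

text \<open>
  The topmost stack symbol is kept in the control state, and the rest of the stack is a number in
  base \<open>|\<Gamma>| + 1\<close> held by one counter; pushing and popping are multiplication and division by the
  base with the help of a second counter, which is 0 whenever a symbol is awaited.  The
  \<open>\<epsilon>\<close>-sequence of the DPDA started on a fixed short stack either exhausts it, or stops above its
  bottom, or never ends, and this outcome is stored in the transition table; so the machine always
  settles, even where the DPDA loops.  The counter values at the timesteps of an episode thus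
  correspond to stacks of the DPDA.  With \<open>m\<close> and \<open>e\<close> as in the theorem, an input symbol adds at most
  \<open>m + m * e\<close> to the height of the stack, so there are at most a constant times
  \<open>|\<Gamma>| ^ (n * m * (e + 1))\<close> of them.
\<close>

section \<open>Runs\<close>

text \<open>Weights never influence which steps are possible, so rewards and push counts can be put
  on any run known only through \<open>reaches\<close>.\<close>

lemma reaches_iff_run: "reaches step c w c' \<longleftrightarrow> (\<exists>r. run step wt c w r c')"
proof
  have "run step wt' c w r' c' \<Longrightarrow> \<exists>r. run step wt c w r c'" for wt' :: "'a \<Rightarrow> 'b option \<Rightarrow> nat" and r'
    by (induction rule: run.induct) (blast intro: run.intros)+
  then show "reaches step c w c' \<Longrightarrow> \<exists>r. run step wt c w r c'"
    unfolding reaches_def by blast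
next
  have "run step wt c w r c' \<Longrightarrow> run step (\<lambda>_ _. 0::nat) c w 0 c'" for r
  proof (induction rule: run.induct)
    case (run_refl c)
    show ?case by (rule run.run_refl)
  next
    case (run_eps c c' w r c'')
    show ?case using run.run_eps[OF run_eps(1,3)] by simp
  next
    case (run_read c a c' w r c'')
    show ?case using run.run_read[OF run_read(1,3)] by simp
  qed
  then show "\<exists>r. run step wt c w r c' \<Longrightarrow> reaches step c w c'"
    unfolding reaches_def by blast
qed

lemma run_imp_reaches: "run step wt c w r c' \<Longrightarrow> reaches step c w c'"
  using reaches_iff_run by metis

lemma reaches_refl [simp]: "reaches step c [] c"
  unfolding reaches_def by (rule run_refl)

lemma reaches_eps:
  assumes "step c None = Some c'" "reaches step c' w c''"
  shows "reaches step c w c''"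
  using run_eps[where wt = "\<lambda>_ _. 0::nat", OF assms(1) assms(2)[unfolded reaches_def]]
  by (simp add: reaches_def)

lemma reaches_read:
  assumes "step c (Some a) = Some c'" "reaches step c' w c''"
  shows "reaches step c (a # w) c''"
  using run_read[where wt = "\<lambda>_ _. 0::nat", OF assms(1) assms(2)[unfolded reaches_def]]
  by (simp add: reaches_def)

lemma reaches_induct [consumes 1, case_names refl eps read]:
  assumes "reaches step c w c'"
    and "\<And>c. P c [] c"
    and "\<And>c c' w c''. step c None = Some c' \<Longrightarrow> reaches step c' w c'' \<Longrightarrow> P c' w c'' \<Longrightarrow> P c w c''"
    and "\<And>c a c' w c''. step c (Some a) = Some c' \<Longrightarrow> reaches step c' w c'' \<Longrightarrow> P c' w c''
      \<Longrightarrow> P c (a # w) c''"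
  shows "P c w c'"
proof -
  have "run step (\<lambda>_ _. 0::nat) c w r c' \<Longrightarrow> P c w c'" for r
    by (induction rule: run.induct) (auto intro: assms(2-4) dest: run_imp_reaches)
  with assms(1) show ?thesis
    unfolding reaches_def by blast
qed

lemma reaches_cases [consumes 1, case_names refl eps read]:
  assumes "reaches step c w c'"
  obtains "w = []" "c' = c"
  | d where "step c None = Some d" "reaches step d w c'"
  | a v d where "w = a # v" "step c (Some a) = Some d" "reaches step d v c'"
  using assms unfolding reaches_def
  by (cases rule: run.cases) (auto dest: run_imp_reaches simp flip: reaches_def)

lemma reaches_append:
  assumes "reaches step c u c'" "reaches step c' v c''"
  shows "reaches step c (u @ v) c''"
  using assms by (induction rule: reaches_induct) (auto intro: reaches_eps reaches_read)

lemma reaches_eps_trans: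
  "reaches step c [] c' \<Longrightarrow> reaches step c' w c'' \<Longrightarrow> reaches step c w c''"
  using reaches_append[of step c "[]"] by simp

text \<open>Runs are built from the front, whereas timesteps extend a history at its end. The
  trailing \<open>[]\<close> run is the epsilon-sequence after the last symbol.\<close>

lemma reaches_snoc_iff:
  "reaches step c (w @ [a]) d \<longleftrightarrow>
    (\<exists>c1 c2. reaches step c w c1 \<and> step c1 (Some a) = Some c2 \<and> reaches step c2 [] d)"
proof
  assume "reaches step c (w @ [a]) d"
  then show "\<exists>c1 c2. reaches step c w c1 \<and> step c1 (Some a) = Some c2 \<and> reaches step c2 [] d"
  proof (induction c "w @ [a]" d arbitrary: w rule: reaches_induct)
    case (refl c)
    then show ?case by simp
  next
    case (eps c c' c'')
    then show ?case by (meson reaches_eps)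
  next
    case (read c b c' v c'')
    show ?case
    proof (cases w)
      case Nil
      with read show ?thesis by (auto intro: exI[of _ c])
    next
      case (Cons b' w')
      with read show ?thesis by (auto intro: reaches_read)
    qed
  qed
next
  assume "\<exists>c1 c2. reaches step c w c1 \<and> step c1 (Some a) = Some c2 \<and> reaches step c2 [] d"
  then show "reaches step c (w @ [a]) d"
    by (auto intro: reaches_append reaches_read)
qed

section \<open>Settled configurations and determinism\<close>

lemma reaches_settled:
  assumes "settled step c" "reaches step c [] d"
  shows "d = c"
  using assms(2,1) by (cases rule: reaches_cases) (auto simp: settled_def)

definition deterministic :: "('c \<Rightarrow> 'a option \<Rightarrow> 'c option) \<Rightarrow> bool" where
  "deterministic step \<longleftrightarrow> (\<forall>c. step c None \<noteq> None \<longrightarrow> (\<forall>a. step c (Some a) = None))"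

text \<open>Determinism makes one of the two runs a prefix of the other. As \<open>e\<close> is
  settled, its run cannot stop short of \<open>d\<close> within an epsilon-sequence.\<close>

lemma reaches_settled_continue:
  assumes "deterministic step" "reaches step c u d" "reaches step c (u @ v) e" "settled step e"
  shows "reaches step d v e"
  using assms(2,3)
proof (induction rule: reaches_induct)
  case (refl c)
  then show ?case by simp
next
  case (eps c c' u d)
  from eps.prems show ?case
    by (cases rule: reaches_cases) (use eps assms(1,4) in \<open>auto simp: settled_def deterministic_def\<close>)
next
  case (read c a c' u d)
  from read.prems show ?case
    by (cases rule: reaches_cases) (use read assms(1) in \<open>fastforce simp: deterministic_def\<close>)+
qed

lemma reaches_settled_unique:
  assumes "deterministic step" "reaches step c w d" "settled step d"
    "reaches step c w e" "settled step e"
  shows "d = e"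
proof -
  have "reaches step d [] e"
    using reaches_settled_continue[of step c w d "[]" e] assms by simp
  with assms(3) show ?thesis by (auto dest: reaches_settled)
qed

text \<open>On the image of \<open>h\<close> the two step functions mirror each other, also where
  they are undefined, so runs transfer in both directions. This serves to rename control
  states.\<close>

lemma reaches_map:
  assumes "\<And>c x. step' (h c) x = map_option h (step c x)"
  shows "reaches step' (h c) w d' \<longleftrightarrow> (\<exists>d. d' = h d \<and> reaches step c w d)"
proof
  assume "reaches step' (h c) w d'"
  then show "\<exists>d. d' = h d \<and> reaches step c w d"
  proof (induction "h c" w d' arbitrary: c rule: reaches_induct)
    case refl
    show ?case by auto
  next
    case (eps c1 w d')
    then show ?case by (fastforce simp: assms intro: reaches_eps)
  next
    case (read a c1 w d')
    then show ?case by (fastforce simp: assms intro: reaches_read)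
  qed
next
  have "reaches step' (h c) w (h d)" if "reaches step c w d" for d
    using that by (induction rule: reaches_induct)
      (auto simp: assms intro: reaches_eps[where c' = "h _"] reaches_read[where c' = "h _"])
  then show "\<exists>d. d' = h d \<and> reaches step c w d \<Longrightarrow> reaches step' (h c) w d'"
    by blast
qed

text \<open>Counting also the start configuration makes the claim inductive: \<open>P\<close> fails at every
  configuration that is left by an \<open>\<epsilon>\<close>-transition.\<close>

lemma run_reward_eps:
  fixes wt :: "'c \<Rightarrow> 'a option \<Rightarrow> real"
  assumes wt: "\<And>c x c'. step c x = Some c' \<Longrightarrow> wt c x = of_bool (P c')"
    and P: "\<And>c. P c \<Longrightarrow> settled step c"
    and "run step wt c [] r d" "settled step d"
  shows "of_bool (P c) + r = of_bool (P d)"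
  using assms(3,4)
proof (induction c "[] :: 'a list" r d rule: run.induct)
  case (run_refl c)
  then show ?case by simp
next
  case (run_eps c c' r d)
  then have "\<not> P c" using P by (auto simp: settled_def)
  with run_eps(3)[OF run_eps(4)] wt[OF run_eps(1)] show ?case by simp
qed

text \<open>A settled \<open>c\<close> forces the run to begin by reading. That transition pays for
  its target, and the epsilon-steps pay exactly the difference to \<open>P d\<close>.\<close>

lemma run_reward_read:
  fixes wt :: "'c \<Rightarrow> 'a option \<Rightarrow> real"
  assumes wt: "\<And>c x c'. step c x = Some c' \<Longrightarrow> wt c x = of_bool (P c')"
    and P: "\<And>c. P c \<Longrightarrow> settled step c"
    and "run step wt c [a] r d" "settled step c" "settled step d"
  shows "r = of_bool (P d)"
  using assms(3)
proof (cases rule: run.cases)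
  case (run_eps c' r')
  then show ?thesis using assms(4) by (simp add: settled_def)
next
  case (run_read c' r')
  have "of_bool (P c') + r' = of_bool (P d)"
    by (rule run_reward_eps[OF wt P run_read(3) assms(5)])
  with run_read(1) wt[OF run_read(2)] show ?thesis by simp
qed


section \<open>Reward automata paying on entry to a final state\<close>

text \<open>The control states become natural numbers through the injection \<open>to_nat\<close>.
  Values of \<open>from_nat\<close> at numbers that are no codes are harmless, as
  \<open>cm_states\<close> contains only codes.\<close>

definition nat_cra :: "('s::countable, 'a) counter_machine \<Rightarrow> (nat, 'a) cra" where
  "nat_cra C =
    \<lparr>cm_states = to_nat ` cm_states C, cm_counters = cm_counters C,
     cm_init = to_nat (cm_init C), cm_final = to_nat ` cm_final C,
     cm_trans = (\<lambda>n x z. map_option (map_prod to_nat id) (cm_trans C (from_nat n) x z)),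
     cra_reward = (\<lambda>n x z. case cm_trans C (from_nat n) x z of
        None \<Rightarrow> 0 | Some (s, us) \<Rightarrow> of_bool (s \<in> cm_final C))\<rparr>"

lemma is_counter_machine_nat_cra:
  assumes "is_counter_machine C"
  shows "is_counter_machine (nat_cra C)"
proof -
  have trans: "q' \<in> cm_states C \<and> length us = cm_counters C \<and>
      (\<forall>i<cm_counters C. us ! i = Decr \<longrightarrow> \<not> z ! i)"
    if "q \<in> cm_states C" "length z = cm_counters C" "cm_trans C q x z = Some (q', us)"
    for q x z q' us
    using assms that unfolding is_counter_machine_def by blast
  have det: "cm_trans C q (Some a) z = None"
    if "q \<in> cm_states C" "length z = cm_counters C" "cm_trans C q None z \<noteq> None" for q z a
    using assms that unfolding is_counter_machine_def by blast
  show ?thesis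
    using assms trans det unfolding is_counter_machine_def nat_cra_def by auto
qed

lemma cm_step_nat_cra:
  "cm_step (nat_cra C) (map_prod to_nat id c) x = map_option (map_prod to_nat id) (cm_step C c x)"
  by (cases c) (simp add: nat_cra_def option.map_comp comp_def case_prod_beta)

lemma timestep_nat_cra:
  "timestep (nat_cra C) w c' \<longleftrightarrow> (\<exists>c. c' = map_prod to_nat id c \<and> timestep C w c)"
proof -
  have start: "cm_start (nat_cra C) = map_prod to_nat id (cm_start C)"
    by (simp add: cm_start_def nat_cra_def)
  show ?thesis
    unfolding timestep_def start reaches_map[of _ "map_prod to_nat id" "cm_step C", OF cm_step_nat_cra]
    by (auto simp only: settled_def cm_step_nat_cra option.map_disc_iff)
qed

lemma counter_configs_nat_cra: "counter_configs (nat_cra C) n = counter_configs C n"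
  by (auto simp: counter_configs_def timestep_nat_cra)

lemma cm_language_nat_cra: "cm_language (nat_cra C) = cm_language C"
proof -
  have start: "cm_start (nat_cra C) = map_prod to_nat id (cm_start C)"
    by (simp add: cm_start_def nat_cra_def)
  have final: "to_nat s \<in> cm_final (nat_cra C) \<longleftrightarrow> s \<in> cm_final C" for s
    by (auto simp: nat_cra_def)
  show ?thesis
    unfolding cm_language_def start reaches_map[of _ "map_prod to_nat id" "cm_step C", OF cm_step_nat_cra]
    by (auto simp: final) (metis final)
qed

text \<open>Determinism makes the configuration at a timestep unique, so the exhibited one decides
  membership. Final states have no epsilon-transitions, so acceptance amid an epsilon-sequence
  coincides with acceptance at the timestep.\<close>

lemma encodes_nat_cra:
  assumes det: "deterministic (cm_step C)"
    and final: "\<And>q z. q \<in> cm_final C \<Longrightarrow> cm_trans C q None z = None"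
    and ex: "\<And>w. \<exists>c. timestep C w c \<and> (fst c \<in> cm_final C \<longleftrightarrow> w \<in> L)"
  shows "encodes (nat_cra C) L"
proof -
  have uniq: "fst c \<in> cm_final C \<longleftrightarrow> w \<in> L" if "timestep C w c" for w c
    using ex[of w] that reaches_settled_unique[OF det] unfolding timestep_def by metis
  have settled: "settled (cm_step C) c" if "fst c \<in> cm_final C" for c
    using that final by (cases c) (auto simp: settled_def)
  have lang: "cm_language C = L"
  proof (intro set_eqI iffI)
    fix w assume "w \<in> cm_language C"
    then obtain c where "reaches (cm_step C) (cm_start C) w c" "fst c \<in> cm_final C"
      by (auto simp: cm_language_def)
    with settled uniq show "w \<in> L" unfolding timestep_def by blast
  next
    fix w assume "w \<in> L"
    with ex[of w] show "w \<in> cm_language C"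
      by (fastforce simp: cm_language_def timestep_def)
  qed
  define P where "P = (\<lambda>c :: nat \<times> nat list. (from_nat (fst c) :: 'a) \<in> cm_final C)"
  have wt: "reward_output (nat_cra C) c x = of_bool (P c')"
    if "cm_step (nat_cra C) c x = Some c'" for c x c'
    using that by (cases c) (auto simp: nat_cra_def P_def)
  have P: "settled (cm_step (nat_cra C)) c" if "P c" for c
    using that final by (cases c) (auto simp: settled_def nat_cra_def P_def)
  have "r = (if w @ [a] \<in> L then 1 else 0)"
    if "timestep (nat_cra C) w c" "run (cm_step (nat_cra C)) (reward_output (nat_cra C)) c [a] r c'"
      "settled (cm_step (nat_cra C)) c'" for w a c c' r
  proof -
    have "r = of_bool (P c')"
      using run_reward_read[where step = "cm_step (nat_cra C)" and P = P, OF wt P that(2) _ that(3)]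
        that(1) by (simp add: timestep_def)
    moreover have "timestep (nat_cra C) (w @ [a]) c'"
      using that reaches_append[OF _ run_imp_reaches[OF that(2)]] by (simp add: timestep_def)
    then obtain d where "c' = map_prod to_nat id d" "timestep C (w @ [a]) d"
      by (auto simp: timestep_nat_cra)
    with uniq have "P c' \<longleftrightarrow> w @ [a] \<in> L"
      by (simp add: P_def)
    ultimately show ?thesis by simp
  qed
  moreover have "\<exists>c. timestep (nat_cra C) w c" for w
    using ex[of w] by (auto simp: timestep_nat_cra)
  ultimately show ?thesis
    using lang unfolding encodes_def cm_language_nat_cra by blast
qed


section \<open>\<open>\<epsilon>\<close>-sequences of pushdown automata\<close>

lemma deterministic_pda_step: "is_dpda M \<Longrightarrow> deterministic (pda_step M)"
  unfolding deterministic_def is_dpda_def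
proof (intro allI impI, goal_cases)
  case (1 c a)
  then show ?case by (cases c, cases "snd c") auto
qed

lemma settled_pda_Nil [simp]: "settled (pda_step M) (q, [])"
  by (simp add: settled_def)

lemma settled_pda_append [simp]: "settled (pda_step M) (q, X # \<gamma> @ \<eta>) \<longleftrightarrow> settled (pda_step M) (q, X # \<gamma>)"
  by (simp add: settled_def)

lemma reaches_pda_append:
  "reaches (pda_step M) (q, \<gamma>) w (p, \<delta>) \<Longrightarrow> reaches (pda_step M) (q, \<gamma> @ \<eta>) w (p, \<delta> @ \<eta>)"
proof (induction "(q, \<gamma>)" w "(p, \<delta>)" arbitrary: q \<gamma> rule: reaches_induct)
  case refl
  then show ?case by simp
next
  case (eps c' w)
  then show ?case by (cases \<gamma>) (auto intro: reaches_eps)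
next
  case (read a c' w)
  then show ?case by (cases \<gamma>) (auto intro: reaches_read)
qed

text \<open>Only the topmost symbol influences a step: either \<open>\<eta>\<close> stays untouched,
  or \<open>\<gamma>\<close> is first used up and the rest of the computation runs on
  \<open>\<eta>\<close> alone.\<close>

lemma reaches_pda_split:
  fixes M :: "('q, 'a, 'g) dpda"
  shows "reaches (pda_step M) (q, \<gamma> @ \<eta>) [] (p, \<delta>) \<Longrightarrow>
    (\<exists>\<delta>'. \<delta> = \<delta>' @ \<eta> \<and> reaches (pda_step M) (q, \<gamma>) [] (p, \<delta>')) \<or>
    (\<exists>r. reaches (pda_step M) (q, \<gamma>) [] (r, []) \<and> reaches (pda_step M) (r, \<eta>) [] (p, \<delta>))"
proof (induction "(q, \<gamma> @ \<eta>)" "[] :: 'a list" "(p, \<delta>)" arbitrary: q \<gamma> rule: reaches_induct)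
  case refl
  then show ?case by auto
next
  case (eps c')
  show ?case
  proof (cases \<gamma>)
    case Nil
    with eps(1,2) have "reaches (pda_step M) (q, \<eta>) [] (p, \<delta>)"
      by (auto intro: reaches_eps)
    with Nil show ?thesis by (metis reaches_refl)
  next
    case (Cons X \<gamma>')
    with eps(1) obtain r \<alpha> where r: "pda_trans M q None X = Some (r, \<alpha>)" "c' = (r, (\<alpha> @ \<gamma>') @ \<eta>)"
      by auto
    then have "pda_step M (q, \<gamma>) None = Some (r, \<alpha> @ \<gamma>')"
      by (simp add: Cons)
    then have "reaches (pda_step M) (q, \<gamma>) [] d" if "reaches (pda_step M) (r, \<alpha> @ \<gamma>') [] d" for d
      using that by (rule reaches_eps)
    with eps(3)[OF r(2)] show ?thesis
      by blast
  qed
qed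

text \<open>Acceptance may occur anywhere in an epsilon-sequence, even an infinite one, so the whole
  sequence is inspected and not just its end.\<close>

definition visits_final :: "('q, 'a, 'g) dpda \<Rightarrow> 'q \<times> 'g list \<Rightarrow> bool" where
  "visits_final M c \<longleftrightarrow> (\<exists>p \<delta>. reaches (pda_step M) c [] (p, \<delta>) \<and> p \<in> pda_final M)"

text \<open>Lets the acceptance flag be accumulated piece by piece while the stack is consumed from
  the top.\<close>

lemma visits_final_append:
  "visits_final M (p, \<alpha> @ \<gamma>) \<longleftrightarrow> visits_final M (p, \<alpha>) \<or>
    (\<exists>q. reaches (pda_step M) (p, \<alpha>) [] (q, []) \<and> visits_final M (q, \<gamma>))"
proof
  assume "visits_final M (p, \<alpha> @ \<gamma>)"
  then show "visits_final M (p, \<alpha>) \<or>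
    (\<exists>q. reaches (pda_step M) (p, \<alpha>) [] (q, []) \<and> visits_final M (q, \<gamma>))"
    unfolding visits_final_def by (blast dest: reaches_pda_split)
next
  assume "visits_final M (p, \<alpha>) \<or>
    (\<exists>q. reaches (pda_step M) (p, \<alpha>) [] (q, []) \<and> visits_final M (q, \<gamma>))"
  then show "visits_final M (p, \<alpha> @ \<gamma>)"
  proof
    assume "visits_final M (p, \<alpha>)"
    then show ?thesis unfolding visits_final_def by (blast dest: reaches_pda_append)
  next
    assume "\<exists>q. reaches (pda_step M) (p, \<alpha>) [] (q, []) \<and> visits_final M (q, \<gamma>)"
    then show ?thesis
      unfolding visits_final_def by (metis append_Nil reaches_eps_trans reaches_pda_append)
  qed
qed


section \<open>Stacks as numbers\<close>

definition digit :: "'g::finite \<Rightarrow> nat" where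
  "digit X = Suc (to_nat_on UNIV X)"

definition symbol :: "nat \<Rightarrow> 'g::finite" where
  "symbol i = from_nat_into UNIV (i - 1)"

lemma symbol_digit [simp]: "symbol (digit X) = X"
  by (simp add: symbol_def digit_def)

lemma digit_le: "digit (X :: 'g::finite) \<le> CARD('g)"
  using bij_betwE[OF to_nat_on_finite[OF finite, of "UNIV :: 'g set"]]
  by (simp add: digit_def Suc_le_eq)

lemma digit_neq_0 [simp]: "digit X \<noteq> 0"
  by (simp add: digit_def)

text \<open>The digit 0 is not used, so that the empty stack is told apart from a nonempty one by the
  remainder of a division by the base.\<close>

fun stack_code :: "'g::finite list \<Rightarrow> nat" where
  "stack_code [] = 0"
| "stack_code (X # \<gamma>) = digit X + Suc CARD('g) * stack_code \<gamma>"

lemma stack_code_mod_div [simp]: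
  fixes X :: "'g::finite"
  shows "stack_code (X # \<gamma>) mod Suc CARD('g) = digit X"
    and "stack_code (X # \<gamma>) div Suc CARD('g) = stack_code \<gamma>"
  using digit_le[of X] by (simp_all del: mult_Suc)


section \<open>The counter machine simulating a pushdown automaton\<close>

text \<open>Between two input symbols the first counter holds the code of the stack below its topmost
  symbol and the second one is 0.  \<open>Live q Z f\<close> waits for input with topmost symbol \<open>Z\<close>, and
  \<open>Dead f\<close> once no transition reading a symbol can occur any more; \<open>f\<close> tells whether the word
  read so far is accepted.  \<open>Div\<close> pops a symbol by dividing the first counter by the base (the
  argument is the remainder), \<open>Mul\<close> pushes one by multiplying it (the argument is the number of
  increments of the second counter still due); the quotient or product arises in the second
  counter and \<open>DivBack\<close> and \<open>MulBack\<close> move it back.  The list is what is still to be pushed.\<close>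

datatype ('q, 'g) ctrl =
  Live 'q 'g bool
| Dead bool
| Div nat 'q bool
| DivBack nat 'q bool
| Mul nat 'q 'g "'g list" bool
| MulBack 'q 'g "'g list" bool

instance ctrl :: (countable, countable) countable
  by countable_datatype

text \<open>The outcome of the whole \<open>\<epsilon>\<close>-sequence of \<open>M\<close> from \<open>(p, \<alpha>)\<close> is built into the transition
  table.  It is not followed step by step, since it may be infinite.\<close>

definition enter :: "('q, 'a, 'g) dpda \<Rightarrow> 'q \<Rightarrow> 'g list \<Rightarrow> bool \<Rightarrow> ('q, 'g) ctrl" where
  "enter M p \<alpha> f =
    (let f' = f \<or> visits_final M (p, \<alpha>);
         halts = (\<lambda>c. reaches (pda_step M) (p, \<alpha>) [] c \<and> settled (pda_step M) c)
     in if \<exists>c. halts c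
        then case Eps halts of (q, []) \<Rightarrow> Div 0 q f' | (q, Z # \<beta>) \<Rightarrow> MulBack q Z (rev \<beta>) f'
        else Dead f')"

text \<open>By determinism a settled outcome is unique, so the choice operator in
  \<open>enter\<close> picks \<open>c\<close>.\<close>

lemma enter_halts:
  assumes "is_dpda M" "reaches (pda_step M) (p, \<alpha>) [] c" "settled (pda_step M) c"
  shows "enter M p \<alpha> f =
    (case c of (q, []) \<Rightarrow> Div 0 q (f \<or> visits_final M (p, \<alpha>))
      | (q, Z # \<beta>) \<Rightarrow> MulBack q Z (rev \<beta>) (f \<or> visits_final M (p, \<alpha>)))"
proof -
  have "(SOME c. reaches (pda_step M) (p, \<alpha>) [] c \<and> settled (pda_step M) c) = c"
    using assms reaches_settled_unique[OF deterministic_pda_step] by blast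
  moreover have "\<exists>c. reaches (pda_step M) (p, \<alpha>) [] c \<and> settled (pda_step M) c"
    using assms by blast
  ultimately show ?thesis unfolding enter_def Let_def by presburger
qed

text \<open>Every \<open>Decr\<close> follows a nonzero test. \<open>Live\<close> and
  \<open>Dead\<close> read all symbols, so the machine never gets stuck. Remainder 0 in
  \<open>DivBack\<close> signals an empty stack, since no symbol has digit 0.\<close>

fun ctrl_trans :: "('q, 'a, 'g::finite) dpda \<Rightarrow> ('q, 'g) ctrl \<Rightarrow> 'a option \<Rightarrow> bool list
    \<Rightarrow> (('q, 'g) ctrl \<times> counter_op list) option" where
  "ctrl_trans M (Live q Z f) (Some a) z =
    Some (case pda_trans M q (Some a) Z of None \<Rightarrow> Dead False | Some (p, \<alpha>) \<Rightarrow> enter M p \<alpha> False,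
      [Keep, Keep])"
| "ctrl_trans M (Dead f) (Some a) z = Some (Dead False, [Keep, Keep])"
| "ctrl_trans M (Div j p f) None z = Some
    (if z ! 0 then (DivBack j p f, [Keep, Keep])
     else if j = CARD('g) then (Div 0 p f, [Decr, Incr])
     else (Div (Suc j) p f, [Decr, Keep]))"
| "ctrl_trans M (DivBack j p f) None z = Some
    (if \<not> z ! 1 then (DivBack j p f, [Incr, Decr])
     else (if j = 0 then Dead f else enter M p [symbol j] f, [Keep, Keep]))"
| "ctrl_trans M (Mul k q Z ys f) None z = Some
    (if k > 0 then (Mul (k - 1) q Z ys f, [Keep, Incr])
     else if z ! 0 then (MulBack q Z ys f, [Keep, Keep])
     else (Mul (Suc CARD('g)) q Z ys f, [Decr, Keep]))"
| "ctrl_trans M (MulBack q Z ys f) None z = Some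
    (if \<not> z ! 1 then (MulBack q Z ys f, [Incr, Decr])
     else (case ys of [] \<Rightarrow> Live q Z f | Y # ys' \<Rightarrow> Mul (digit Y) q Z ys' f, [Keep, Keep]))"
| "ctrl_trans M _ _ _ = None"

section \<open>A finite set of control states closed under transitions\<close>

definition entries :: "('q, 'a, 'g) dpda \<Rightarrow> ('q \<times> 'g list) set" where
  "entries M = range (\<lambda>(p, X). (p, [X])) \<union> {e. \<exists>q x X. pda_trans M q x X = Some e}"

lemma finite_pda_trans:
  "finite {e. \<exists>q x X. pda_trans (M :: ('q::finite, 'a::finite, 'g::finite) dpda) q x X = Some e}"
proof -
  have "e \<in> range (\<lambda>(q, x, X). the (pda_trans M q x X))"
    if "pda_trans M q x X = Some e" for e q x X
    using that by (intro range_eqI[of _ _ "(q, x, X)"]) simp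
  then have "{e. \<exists>q x X. pda_trans M q x X = Some e} \<subseteq> range (\<lambda>(q, x, X). the (pda_trans M q x X))"
    by blast
  then show ?thesis by (rule finite_subset) simp
qed

definition pending :: "('q, 'g) ctrl \<Rightarrow> nat" where
  "pending s = (case s of MulBack q Z ys f \<Rightarrow> length ys | _ \<Rightarrow> 0)"

text \<open>The type \<open>ctrl\<close> is infinite because of its lists. Those created by
  \<open>enter\<close> are bounded, as it is only called on the finitely many
  \<open>entries\<close>: single symbols and right-hand sides of transitions.\<close>

definition max_pending :: "('q, 'a, 'g) dpda \<Rightarrow> nat" where
  "max_pending M = Max ((\<lambda>((p, \<alpha>), f). pending (enter M p \<alpha> f)) ` (entries M \<times> UNIV))"

definition ctrl_states :: "('q, 'a, 'g::finite) dpda \<Rightarrow> ('q, 'g) ctrl set" where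
  "ctrl_states M =
    {Live q Z f | q Z f. True} \<union> range Dead \<union>
    {Div j q f | j q f. j \<le> CARD('g)} \<union> {DivBack j q f | j q f. j \<le> CARD('g)} \<union>
    {Mul k q Z ys f | k q Z ys f. k \<le> Suc CARD('g) \<and> length ys \<le> max_pending M} \<union>
    {MulBack q Z ys f | q Z ys f. length ys \<le> max_pending M}"

lemma ctrl_states_iff [simp]:
  fixes M :: "('q, 'a, 'g::finite) dpda"
  shows "Live q Z f \<in> ctrl_states M" "Dead f \<in> ctrl_states M"
    "Div j q f \<in> ctrl_states M \<longleftrightarrow> j \<le> CARD('g)"
    "DivBack j q f \<in> ctrl_states M \<longleftrightarrow> j \<le> CARD('g)"
    "Mul k q Z ys f \<in> ctrl_states M \<longleftrightarrow> k \<le> Suc CARD('g) \<and> length ys \<le> max_pending M"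
    "MulBack q Z ys f \<in> ctrl_states M \<longleftrightarrow> length ys \<le> max_pending M"
  by (auto simp: ctrl_states_def)

lemma finite_ctrl_states: "finite (ctrl_states (M :: ('q::finite, 'a, 'g::finite) dpda))"
proof -
  have ys: "finite {ys :: 'g list. length ys \<le> max_pending M}"
    using finite_lists_length_le[of "UNIV :: 'g set"] by simp
  have "ctrl_states M \<subseteq>
    range (\<lambda>(q, Z, f). Live q Z f) \<union> range Dead \<union>
    (\<lambda>(j, q, f). Div j q f) ` ({..CARD('g)} \<times> UNIV) \<union>
    (\<lambda>(j, q, f). DivBack j q f) ` ({..CARD('g)} \<times> UNIV) \<union>
    (\<lambda>(k, q, Z, ys, f). Mul k q Z ys f) `
      ({..Suc CARD('g)} \<times> UNIV \<times> UNIV \<times> {ys. length ys \<le> max_pending M} \<times> UNIV) \<union>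
    (\<lambda>(q, Z, ys, f). MulBack q Z ys f) `
      (UNIV \<times> UNIV \<times> {ys. length ys \<le> max_pending M} \<times> UNIV)"
    unfolding ctrl_states_def by (fastforce simp: image_iff)
  moreover have "finite \<dots>"
    using ys by (intro finite_UnI finite_imageI finite_cartesian_product finite_atMost finite)
  ultimately show ?thesis by (rule finite_subset)
qed

lemma enter_in_ctrl_states:
  fixes M :: "('q::finite, 'a::finite, 'g::finite) dpda"
  assumes "(p, \<alpha>) \<in> entries M"
  shows "enter M p \<alpha> f \<in> ctrl_states M"
proof -
  have "finite (entries M)"
    unfolding entries_def using finite_pda_trans[of M] by simp
  then have "pending (enter M p \<alpha> f) \<le> max_pending M"
    unfolding max_pending_def using assms by (intro Max_ge) (auto intro!: rev_image_eqI)
  then show ?thesis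
    by (auto simp: enter_def Let_def pending_def split: prod.splits list.splits if_splits)
qed

definition stack_machine ::
  "('q, 'a, 'g::finite) dpda \<Rightarrow> (('q, 'g) ctrl, 'a) counter_machine" where
  "stack_machine M =
    \<lparr>cm_states = ctrl_states M, cm_counters = 2,
     cm_init = enter M (pda_init M) [pda_bot M] False,
     cm_final = {s. (\<exists>q Z. s = Live q Z True) \<or> s = Dead True},
     cm_trans = ctrl_trans M\<rparr>"

text \<open>Lists only shrink after \<open>enter\<close> has created them, and the increments due in
  \<open>Mul\<close> start at a digit or at the base.\<close>

lemma ctrl_trans_in_ctrl_states:
  fixes M :: "('q::finite, 'a::finite, 'g::finite) dpda"
  assumes "s \<in> ctrl_states M" "ctrl_trans M s x z = Some (s', us)"
  shows "s' \<in> ctrl_states M"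
proof -
  have entry: "enter M p \<alpha> False \<in> ctrl_states M" if "pda_trans M q x X = Some (p, \<alpha>)" for q x X p \<alpha>
    using that by (intro enter_in_ctrl_states) (auto simp: entries_def)
  have single: "enter M p [X] f \<in> ctrl_states M" for p X f
    by (intro enter_in_ctrl_states) (auto simp: entries_def)
  show ?thesis
    using assms
  proof (cases "(M, s, x, z)" rule: ctrl_trans.cases)
    case (1 M' q Z f a z')
    then show ?thesis using assms entry
      by (auto split: option.splits)
  next
    case (4 M' j p f z')
    then show ?thesis using assms single by (auto split: if_splits)
  next
    case (6 M' q Z ys f z')
    then show ?thesis using assms
      by (auto simp: le_SucI digit_le split: if_splits list.splits)
  qed (auto split: if_splits)
qed

lemma is_counter_machine_stack_machine:
  "is_counter_machine (stack_machine (M :: ('q::finite, 'a::finite, 'g::finite) dpda))"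
proof -
  have ops: "length us = 2 \<and> (\<forall>i<2. us ! i = Decr \<longrightarrow> \<not> z ! i)"
    if "ctrl_trans M s x z = Some (s', us)" for s x z s' us
    using that
    by (cases "(M, s, x, z)" rule: ctrl_trans.cases) (auto simp: less_2_cases_iff split: if_splits)
  have det: "ctrl_trans M s (Some a) z = None" if "ctrl_trans M s None z \<noteq> None" for s a z
    using that by (cases s) auto
  have "enter M (pda_init M) [pda_bot M] False \<in> ctrl_states M"
    by (intro enter_in_ctrl_states) (auto simp: entries_def)
  moreover have "{s. (\<exists>q Z. s = Live q Z True) \<or> s = Dead True} \<subseteq> ctrl_states M"
    by auto
  ultimately show ?thesis
    using ctrl_trans_in_ctrl_states[of _ M] ops det finite_ctrl_states[of M]
    unfolding is_counter_machine_def stack_machine_def by auto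
qed

lemma cm_trans_stack_machine [simp]: "cm_trans (stack_machine M) = ctrl_trans M"
  by (simp add: stack_machine_def)

lemma zero_tests_simps [simp]: "zero_tests [] = []" "zero_tests (c # cs) = (c = 0) # zero_tests cs"
  by (simp_all add: zero_tests_def)

lemma deterministic_stack_machine: "deterministic (cm_step (stack_machine M))"
  unfolding deterministic_def
proof (intro allI impI)
  fix c a
  assume "cm_step (stack_machine M) c None \<noteq> None"
  then show "cm_step (stack_machine M) c (Some a) = None"
    by (cases c, cases "fst c") (auto simp: stack_machine_def)
qed

lemma settled_stack_machine [simp]:
  "settled (cm_step (stack_machine M)) (Live q Z f, cs)"
  "settled (cm_step (stack_machine M)) (Dead f, cs)"
  by (simp_all add: settled_def stack_machine_def)


section \<open>Correctness of the simulation\<close>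

text \<open>Counting down \<open>v\<close> cycles the remainder through the base and moves one unit
  to the second counter per full cycle. Arbitrary \<open>j\<close> and \<open>u\<close> make the
  claim inductive.\<close>

lemma reaches_Div:
  fixes M :: "('q, 'a, 'g::finite) dpda"
  assumes "j \<le> CARD('g)"
  shows "reaches (cm_step (stack_machine M)) (Div j p f, [v, u]) []
    (DivBack ((j + v) mod Suc CARD('g)) p f, [0, u + (j + v) div Suc CARD('g)])"
  using assms
proof (induction v arbitrary: j u)
  case 0
  then show ?case
    by (intro reaches_eps[OF _ reaches_refl]) simp
next
  case (Suc v)
  show ?case
  proof (cases "j = CARD('g)")
    case True
    \<comment> \<open>At the largest remainder one more decrement completes a cycle: the quotient
      gains 1 and the remainder restarts at 0.\<close>
    then have *: "j + Suc v = v + Suc CARD('g)"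
      by simp
    have div_eq: "(j + Suc v) div Suc CARD('g) = v div Suc CARD('g) + 1"
      unfolding * by (rule div_add_self2) simp
    have mod_eq: "(j + Suc v) mod Suc CARD('g) = v mod Suc CARD('g)"
      unfolding * by (rule mod_add_self2)
    have "reaches (cm_step (stack_machine M)) (Div 0 p f, [v, Suc u]) []
      (DivBack (v mod Suc CARD('g)) p f, [0, u + (v div Suc CARD('g) + 1)])"
      using Suc.IH[of 0 "Suc u"] by simp
    then show ?thesis
      unfolding div_eq mod_eq by (rule reaches_eps[rotated]) (simp add: True)
  next
    case False
    with Suc.prems have "Suc j \<le> CARD('g)"
      by simp
    from Suc.IH[OF this, of u] have "reaches (cm_step (stack_machine M)) (Div (Suc j) p f, [v, u]) []
      (DivBack ((j + Suc v) mod Suc CARD('g)) p f, [0, u + (j + Suc v) div Suc CARD('g)])"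
      by (simp only: add_Suc add_Suc_right)
    then show ?thesis
      by (rule reaches_eps[rotated]) (simp add: False)
  qed
qed

lemma reaches_DivBack:
  "reaches (cm_step (stack_machine M)) (DivBack j p f, [v, u]) [] (DivBack j p f, [v + u, 0])"
proof (induction u arbitrary: v)
  case (Suc u)
  show ?case
    by (rule reaches_eps[where c' = "(DivBack j p f, [Suc v, u])"]) (use Suc[of "Suc v"] in simp_all)
qed simp

lemma reaches_pop:
  "reaches (cm_step (stack_machine M)) (Div 0 p f, [stack_code (X # \<gamma>), 0]) []
    (enter M p [X] f, [stack_code \<gamma>, 0])"
proof -
  have "reaches (cm_step (stack_machine M)) (Div 0 p f, [stack_code (X # \<gamma>), 0]) []
    (DivBack (digit X) p f, [0, stack_code \<gamma>])"
    using reaches_Div[of 0 M p f "stack_code (X # \<gamma>)" 0] by (simp only: add_0 stack_code_mod_div le0)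
  moreover have "reaches (cm_step (stack_machine M)) (DivBack (digit X) p f, [0, stack_code \<gamma>]) []
    (DivBack (digit X) p f, [stack_code \<gamma>, 0])"
    using reaches_DivBack[of M _ _ _ 0] by simp
  moreover have "reaches (cm_step (stack_machine M)) (DivBack (digit X) p f, [stack_code \<gamma>, 0]) []
    (enter M p [X] f, [stack_code \<gamma>, 0])"
    by (intro reaches_eps[OF _ reaches_refl]) simp
  ultimately show ?thesis by (blast intro: reaches_eps_trans)
qed

lemma reaches_pop_Nil:
  "reaches (cm_step (stack_machine M)) (Div 0 p f, [0, 0]) [] (Dead f, [0, 0])"
  by (rule reaches_eps[where c' = "(DivBack 0 p f, [0, 0])"], simp)
    (rule reaches_eps[OF _ reaches_refl], simp)

lemma reaches_Mul_increments:
  "reaches (cm_step (stack_machine M)) (Mul k q Z ys f, [v, u]) [] (Mul 0 q Z ys f, [v, u + k])"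
proof (induction k arbitrary: u)
  case (Suc k)
  show ?case
    by (rule reaches_eps[where c' = "(Mul k q Z ys f, [v, Suc u])"]) (use Suc[of "Suc u"] in simp_all)
qed simp

text \<open>The first \<open>k\<close> increments supply the new lowest digit; thereafter each
  decrement of the first counter buys a whole base in the second.\<close>

lemma reaches_Mul:
  fixes M :: "('q, 'a, 'g::finite) dpda"
  shows "reaches (cm_step (stack_machine M)) (Mul k q Z ys f, [v, u]) []
    (MulBack q Z ys f, [0, u + (k + Suc CARD('g) * v)])"
proof (induction v arbitrary: k u)
  case 0
  have "reaches (cm_step (stack_machine M)) (Mul 0 q Z ys f, [0, u + k]) [] (MulBack q Z ys f, [0, u + k])"
    by (intro reaches_eps[OF _ reaches_refl]) simp
  with reaches_Mul_increments[of M k q Z ys f 0 u] show ?case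
    by (auto intro: reaches_eps_trans)
next
  case (Suc v)
  have "u + k + (Suc CARD('g) + Suc CARD('g) * v) = u + (k + Suc CARD('g) * Suc v)"
    by simp
  then have "reaches (cm_step (stack_machine M)) (Mul (Suc CARD('g)) q Z ys f, [v, u + k]) []
    (MulBack q Z ys f, [0, u + (k + Suc CARD('g) * Suc v)])"
    using Suc.IH[of "Suc CARD('g)" "u + k"] by (simp only:)
  then have "reaches (cm_step (stack_machine M)) (Mul 0 q Z ys f, [Suc v, u + k]) []
    (MulBack q Z ys f, [0, u + (k + Suc CARD('g) * Suc v)])"
    by (rule reaches_eps[rotated]) simp
  with reaches_Mul_increments show ?case
    by (rule reaches_eps_trans)
qed

lemma reaches_MulBack:
  "reaches (cm_step (stack_machine M)) (MulBack q Z ys f, [v, u]) [] (MulBack q Z ys f, [v + u, 0])"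
proof (induction u arbitrary: v)
  case (Suc u)
  show ?case
    by (rule reaches_eps[where c' = "(MulBack q Z ys f, [Suc v, u])"]) (use Suc[of "Suc v"] in simp_all)
qed simp

text \<open>The list holds the symbol to be pushed first at its head, hence the reversal.\<close>

lemma reaches_push:
  fixes M :: "('q, 'a, 'g::finite) dpda"
  shows "reaches (cm_step (stack_machine M)) (MulBack q Z ys f, [stack_code \<gamma>, 0]) []
    (Live q Z f, [stack_code (rev ys @ \<gamma>), 0])"
proof (induction ys arbitrary: \<gamma>)
  case Nil
  show ?case by (intro reaches_eps[OF _ reaches_refl]) simp
next
  case (Cons Y ys)
  have "reaches (cm_step (stack_machine M)) (Mul (digit Y) q Z ys f, [stack_code \<gamma>, 0]) []
    (MulBack q Z ys f, [0, stack_code (Y # \<gamma>)])"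
    using reaches_Mul[of M "digit Y" q Z ys f "stack_code \<gamma>" 0] by (simp only: add_0 stack_code.simps)
  moreover have "reaches (cm_step (stack_machine M)) (MulBack q Z ys f, [0, stack_code (Y # \<gamma>)]) []
    (MulBack q Z ys f, [stack_code (Y # \<gamma>), 0])"
    using reaches_MulBack[of M q Z ys f 0 "stack_code (Y # \<gamma>)"] by (simp only: add_0)
  moreover have "reaches (cm_step (stack_machine M)) (MulBack q Z ys f, [stack_code (Y # \<gamma>), 0]) []
    (Live q Z f, [stack_code (rev (Y # ys) @ \<gamma>), 0])"
    using Cons[of "Y # \<gamma>"] by (simp only: rev.simps append_assoc append.simps)
  ultimately have "reaches (cm_step (stack_machine M)) (Mul (digit Y) q Z ys f, [stack_code \<gamma>, 0]) []
    (Live q Z f, [stack_code (rev (Y # ys) @ \<gamma>), 0])"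
    by (blast intro: reaches_eps_trans)
  then show ?case
    by (rule reaches_eps[rotated]) simp
qed

text \<open>\<open>Dead\<close> covers an infinite \<open>\<epsilon>\<close>-sequence, an emptied stack and a missing transition alike:
  in all these cases \<open>M\<close> cannot read a further symbol.\<close>

definition tracks ::
  "('q, 'a, 'g) dpda \<Rightarrow> 'q \<times> 'g list \<Rightarrow> 'a list \<Rightarrow> bool \<Rightarrow> ('q, 'g) ctrl \<Rightarrow> 'g list \<Rightarrow> bool" where
  "tracks M c w f s \<delta> \<longleftrightarrow>
    (\<exists>q Z. s = Live q Z f \<and> reaches (pda_step M) c w (q, Z # \<delta>) \<and> settled (pda_step M) (q, Z # \<delta>)) \<or>
    (s = Dead f \<and> (\<forall>q Z \<eta>. reaches (pda_step M) c w (q, Z # \<eta>) \<longrightarrow>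
      \<not> settled (pda_step M) (q, Z # \<eta>)))"

text \<open>The \<open>Dead\<close> case is where determinism enters: a settled configuration
  reached from \<open>c\<close> is also reached from \<open>c'\<close>.\<close>

lemma tracks_eps:
  assumes "is_dpda M" "reaches (pda_step M) c [] c'" "tracks M c' w f s \<delta>"
  shows "tracks M c w f s \<delta>"
  using assms(3) unfolding tracks_def
proof (elim disjE exE conjE)
  fix q Z
  assume "s = Live q Z f" "reaches (pda_step M) c' w (q, Z # \<delta>)" "settled (pda_step M) (q, Z # \<delta>)"
  then show "(\<exists>q Z. s = Live q Z f \<and> reaches (pda_step M) c w (q, Z # \<delta>) \<and>
      settled (pda_step M) (q, Z # \<delta>)) \<or>
    (s = Dead f \<and> (\<forall>q Z \<eta>. reaches (pda_step M) c w (q, Z # \<eta>) \<longrightarrow>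
      \<not> settled (pda_step M) (q, Z # \<eta>)))"
    using reaches_eps_trans[OF assms(2)] by blast
next
  assume "s = Dead f"
    "\<forall>q Z \<eta>. reaches (pda_step M) c' w (q, Z # \<eta>) \<longrightarrow> \<not> settled (pda_step M) (q, Z # \<eta>)"
  then show "(\<exists>q Z. s = Live q Z f \<and> reaches (pda_step M) c w (q, Z # \<delta>) \<and>
      settled (pda_step M) (q, Z # \<delta>)) \<or>
    (s = Dead f \<and> (\<forall>q Z \<eta>. reaches (pda_step M) c w (q, Z # \<eta>) \<longrightarrow>
      \<not> settled (pda_step M) (q, Z # \<eta>)))"
    using reaches_settled_continue[OF deterministic_pda_step[OF assms(1)] assms(2), of w]
    by (metis append_Nil)
qed

text \<open>Induction on the lower stack: when \<open>\<alpha>\<close> is used up, the next symbol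
  is popped and \<open>enter\<close> restarts above a shorter stack. The last conjunct controls the
  counter in \<open>Dead\<close> too, where no settled configuration of \<open>M\<close> determines
  it.\<close>

lemma enter_tracks:
  fixes M :: "('q::finite, 'a::finite, 'g::finite) dpda"
  assumes "is_dpda M"
  shows "\<exists>s \<delta> q \<delta>'. reaches (cm_step (stack_machine M)) (enter M p \<alpha> f, [stack_code \<gamma>, 0]) []
        (s, [stack_code \<delta>, 0]) \<and>
      tracks M (p, \<alpha> @ \<gamma>) [] (f \<or> visits_final M (p, \<alpha> @ \<gamma>)) s \<delta> \<and>
      reaches (pda_step M) (p, \<alpha> @ \<gamma>) [] (q, \<delta>' @ \<delta>)"
proof (induction \<gamma> arbitrary: p \<alpha> f rule: length_induct)
  case IH: (1 \<gamma>)
  note det = deterministic_pda_step[OF assms]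
  consider q Z \<beta> where "reaches (pda_step M) (p, \<alpha>) [] (q, Z # \<beta>)" "settled (pda_step M) (q, Z # \<beta>)"
    | q where "reaches (pda_step M) (p, \<alpha>) [] (q, [])"
    | "\<And>c. reaches (pda_step M) (p, \<alpha>) [] c \<Longrightarrow> \<not> settled (pda_step M) c"
  proof (cases "\<exists>c. reaches (pda_step M) (p, \<alpha>) [] c \<and> settled (pda_step M) c")
    case True
    then obtain q \<delta> where "reaches (pda_step M) (p, \<alpha>) [] (q, \<delta>)" "settled (pda_step M) (q, \<delta>)"
      by auto
    with that(1,2) show ?thesis by (cases \<delta>) auto
  next
    case False
    with that(3) show ?thesis by blast
  qed
  then show ?case
  proof cases
    case (1 q Z \<beta>)
    \<comment> \<open>The settled outcome is unique and nonempty, so \<open>\<gamma>\<close> is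
      never exposed and \<open>\<alpha>\<close> alone decides the acceptance flag.\<close>
    have no_empty: "\<not> reaches (pda_step M) (p, \<alpha>) [] (r, [])" for r
      using reaches_settled_unique[OF det 1, of "(r, [])"] by auto
    define f' where "f' = (f \<or> visits_final M (p, \<alpha> @ \<gamma>))"
    have "enter M p \<alpha> f = MulBack q Z (rev \<beta>) f'"
      using enter_halts[OF assms 1] no_empty by (simp add: visits_final_append f'_def)
    then have "reaches (cm_step (stack_machine M)) (enter M p \<alpha> f, [stack_code \<gamma>, 0]) []
        (Live q Z f', [stack_code (\<beta> @ \<gamma>), 0])"
      using reaches_push[of M q Z "rev \<beta>" f' \<gamma>] by simp
    moreover have reach: "reaches (pda_step M) (p, \<alpha> @ \<gamma>) [] (q, Z # \<beta> @ \<gamma>)"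
      using reaches_pda_append[OF 1(1)] by simp
    then have "tracks M (p, \<alpha> @ \<gamma>) [] f' (Live q Z f') (\<beta> @ \<gamma>)"
      using 1(2) by (simp add: tracks_def)
    ultimately show ?thesis
      using reach unfolding f'_def by (metis append_Cons append_Nil)
  next
    case (2 q)
    define f' where "f' = (f \<or> visits_final M (p, \<alpha>))"
    have uniq: "reaches (pda_step M) (p, \<alpha>) [] (r, []) \<longleftrightarrow> r = q" for r
      using reaches_settled_unique[OF det 2 settled_pda_Nil, of "(r, [])"] 2 by auto
    have enter: "enter M p \<alpha> f = Div 0 q f'"
      using enter_halts[OF assms 2 settled_pda_Nil] by (simp add: f'_def)
    have reach: "reaches (pda_step M) (p, \<alpha> @ \<gamma>) [] (q, \<gamma>)"
      using reaches_pda_append[OF 2, of \<gamma>] by simp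
    have final: "(f \<or> visits_final M (p, \<alpha> @ \<gamma>)) = (f' \<or> visits_final M (q, \<gamma>))"
      by (auto simp: visits_final_append uniq f'_def)
    show ?thesis
    proof (cases \<gamma>)
      case Nil
      \<comment> \<open>A final \<open>q\<close> above nothing was already seen at the end of the
        epsilon-sequence from \<open>\<alpha>\<close>.\<close>
      have "visits_final M (q, []) \<Longrightarrow> visits_final M (p, \<alpha>)"
        unfolding visits_final_def using reaches_eps_trans[OF 2] by blast
      then have f': "(f' \<or> visits_final M (q, [])) = f'"
        by (auto simp: f'_def)
      have "tracks M (q, []) [] f' (Dead f') []"
        using reaches_settled[OF settled_pda_Nil, of M q] by (auto simp: tracks_def)
      with reach have "tracks M (p, \<alpha> @ \<gamma>) [] f' (Dead f') []"
        by (simp add: Nil tracks_eps[OF assms])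
      with reaches_pop_Nil[of M q f'] reach show ?thesis
        unfolding final enter unfolding Nil f'
        by (intro exI[of _ "Dead f'"] exI[of _ "[]"]) auto
    next
      case (Cons X \<eta>)
      from IH[rule_format, of \<eta> q "[X]" f'] obtain s \<delta> r \<delta>' where
        s: "reaches (cm_step (stack_machine M)) (enter M q [X] f', [stack_code \<eta>, 0]) []
            (s, [stack_code \<delta>, 0])"
          "tracks M (q, \<gamma>) [] (f' \<or> visits_final M (q, \<gamma>)) s \<delta>"
          "reaches (pda_step M) (q, \<gamma>) [] (r, \<delta>' @ \<delta>)"
        by (auto simp: Cons)
      have "reaches (cm_step (stack_machine M)) (enter M p \<alpha> f, [stack_code \<gamma>, 0]) []
          (s, [stack_code \<delta>, 0])"
        unfolding enter Cons by (rule reaches_eps_trans[OF reaches_pop s(1)])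
      with tracks_eps[OF assms reach s(2)] reaches_eps_trans[OF reach s(3)] show ?thesis
        unfolding final by blast
    qed
  next
    case 3
    have no_empty: "\<not> reaches (pda_step M) (p, \<alpha>) [] (r, [])" for r
      using 3[of "(r, [])"] by auto
    define f' where "f' = (f \<or> visits_final M (p, \<alpha> @ \<gamma>))"
    have "\<nexists>c. reaches (pda_step M) (p, \<alpha>) [] c \<and> settled (pda_step M) c"
      using 3 by blast
    then have "enter M p \<alpha> f = Dead (f \<or> visits_final M (p, \<alpha>))"
      unfolding enter_def Let_def by (rule if_not_P)
    then have enter: "enter M p \<alpha> f = Dead f'"
      by (simp add: f'_def visits_final_append no_empty)
    \<comment> \<open>The part above \<open>\<gamma>\<close> never empties, so it contains the
      topmost symbol, which alone decides whether the configuration is settled.\<close>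
    have "\<not> settled (pda_step M) (q, Z # \<eta>)"
      if reach: "reaches (pda_step M) (p, \<alpha> @ \<gamma>) [] (q, Z # \<eta>)" for q Z \<eta>
    proof -
      from reaches_pda_split[OF reach] no_empty obtain \<beta> where
        \<beta>: "Z # \<eta> = \<beta> @ \<gamma>" "reaches (pda_step M) (p, \<alpha>) [] (q, \<beta>)"
        by blast
      with no_empty 3 obtain \<beta>' where "\<beta> = Z # \<beta>'"
        by (cases \<beta>) auto
      with \<beta> 3 show ?thesis by auto
    qed
    then have "tracks M (p, \<alpha> @ \<gamma>) [] f' (Dead f') \<gamma>"
      by (simp add: tracks_def)
    then show ?thesis
      unfolding enter f'_def[symmetric] by (blast intro: reaches_refl)
  qed
qed

text \<open>Once \<open>M\<close> can read no further symbol, the counter stays as it was; the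
  possibly shorter word \<open>w'\<close> witnesses that its content still comes from a reachable
  stack.\<close>

lemma timestep_stack_machine:
  fixes M :: "('q::finite, 'a::finite, 'g::finite) dpda"
  assumes "is_dpda M"
  shows "\<exists>s \<delta>. timestep (stack_machine M) w (s, [stack_code \<delta>, 0]) \<and>
    tracks M (pda_start M) w (w \<in> pda_language M) s \<delta> \<and>
    (\<exists>w' q \<delta>'. length w' \<le> length w \<and> reaches (pda_step M) (pda_start M) w' (q, \<delta>' @ \<delta>))"
proof (induction w rule: rev_induct)
  case Nil
  have start: "cm_start (stack_machine M) = (enter M (pda_init M) [pda_bot M] False, [stack_code ([] :: 'g list), 0])"
    by (simp add: cm_start_def stack_machine_def numeral_2_eq_2)
  have lang: "[] \<in> pda_language M \<longleftrightarrow> visits_final M (pda_start M)"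
    by (auto simp: pda_language_def visits_final_def)
  from enter_tracks[OF assms, of "pda_init M" "[pda_bot M]" False "[]"] obtain s \<delta> q \<delta>' where
    s: "reaches (cm_step (stack_machine M)) (cm_start (stack_machine M)) [] (s, [stack_code \<delta>, 0])"
      "tracks M (pda_start M) [] ([] \<in> pda_language M) s \<delta>"
      "reaches (pda_step M) (pda_start M) [] (q, \<delta>' @ \<delta>)"
    unfolding start lang by (auto simp: pda_start_def)
  then have "settled (cm_step (stack_machine M)) (s, [stack_code \<delta>, 0])"
    by (auto simp: tracks_def)
  with s show ?case
    unfolding timestep_def by blast
next
  case (snoc a w)
  then obtain s \<delta> w' q' \<delta>' where
    s: "timestep (stack_machine M) w (s, [stack_code \<delta>, 0])"
      "tracks M (pda_start M) w (w \<in> pda_language M) s \<delta>"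
    and w': "length w' \<le> length w" "reaches (pda_step M) (pda_start M) w' (q', \<delta>' @ \<delta>)"
    by blast
  \<comment> \<open>Reading leaves the counters alone, and \<open>tracks\<close> ensures that the
    state arrived at is \<open>Live\<close> or \<open>Dead\<close>, hence settled.\<close>
  have read: "timestep (stack_machine M) (w @ [a]) (s', [stack_code \<delta>'', 0])"
    if "ctrl_trans M s (Some a) [stack_code \<delta> = 0, True] = Some (s1, [Keep, Keep])"
      "reaches (cm_step (stack_machine M)) (s1, [stack_code \<delta>, 0]) [] (s', [stack_code \<delta>'', 0])"
      "tracks M c v g s' \<delta>''" for s1 s' \<delta>'' c v g
  proof -
    have "cm_step (stack_machine M) (s, [stack_code \<delta>, 0]) (Some a) = Some (s1, [stack_code \<delta>, 0])"
      using that(1) by simp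
    with s(1) that(2) have "reaches (cm_step (stack_machine M)) (cm_start (stack_machine M)) (w @ [a])
        (s', [stack_code \<delta>'', 0])"
      unfolding reaches_snoc_iff timestep_def by blast
    with that(3) show ?thesis
      by (auto simp: timestep_def tracks_def)
  qed
  have settled_if_read: "settled (pda_step M) (r, \<eta>) \<and> \<eta> \<noteq> []"
    if "pda_step M (r, \<eta>) (Some a) = Some d" for r \<eta> d
    using that deterministic_pda_step[OF assms] unfolding deterministic_def settled_def
    by (cases "\<eta> = []") (simp, metis option.distinct(1))
  have dead: ?case
    if "ctrl_trans M s (Some a) [stack_code \<delta> = 0, True] = Some (Dead False, [Keep, Keep])"
      "\<And>c. \<not> reaches (pda_step M) (pda_start M) (w @ [a]) c"
  proof -
    have "tracks M (pda_start M) (w @ [a]) (w @ [a] \<in> pda_language M) (Dead False) \<delta>"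
      using that(2) by (auto simp: tracks_def pda_language_def)
    moreover from this have "timestep (stack_machine M) (w @ [a]) (Dead False, [stack_code \<delta>, 0])"
      using read[OF that(1) reaches_refl] by blast
    moreover have "length w' \<le> length (w @ [a])"
      using w'(1) by simp
    ultimately show ?case
      using w'(2) by blast
  qed
  from s(2) consider
    q Z f where "s = Live q Z f" "reaches (pda_step M) (pda_start M) w (q, Z # \<delta>)"
      "settled (pda_step M) (q, Z # \<delta>)"
    | f where "s = Dead f" "\<And>q Z \<eta>. reaches (pda_step M) (pda_start M) w (q, Z # \<eta>) \<Longrightarrow>
      \<not> settled (pda_step M) (q, Z # \<eta>)"
    unfolding tracks_def by blast
  then show ?case
  proof cases
    case (1 q Z f)
    \<comment> \<open>Only a settled configuration can read, and the settled one reached by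
      \<open>w\<close> is unique, so every run on the longer word passes through it.\<close>
    have step: "reaches (pda_step M) (pda_start M) (w @ [a]) d \<longleftrightarrow>
      (\<exists>c. pda_step M (q, Z # \<delta>) (Some a) = Some c \<and> reaches (pda_step M) c [] d)" for d
      unfolding reaches_snoc_iff
      using 1(2,3) settled_if_read reaches_settled_unique[OF deterministic_pda_step[OF assms]]
      by (metis surj_pair)
    show ?thesis
    proof (cases "pda_trans M q (Some a) Z")
      case None
      show ?thesis
        by (rule dead) (simp_all add: 1(1) None step)
    next
      case (Some e)
      obtain p \<alpha> where e: "e = (p, \<alpha>)" by fastforce
      have step': "reaches (pda_step M) (pda_start M) (w @ [a]) d \<longleftrightarrow>
          reaches (pda_step M) (p, \<alpha> @ \<delta>) [] d" for d
        by (simp add: step Some e)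
      have lang: "w @ [a] \<in> pda_language M \<longleftrightarrow> visits_final M (p, \<alpha> @ \<delta>)"
        by (auto simp: pda_language_def visits_final_def step')
      from enter_tracks[OF assms, of p \<alpha> False \<delta>] obtain s' \<delta>'' r \<eta> where
        s': "reaches (cm_step (stack_machine M)) (enter M p \<alpha> False, [stack_code \<delta>, 0]) []
            (s', [stack_code \<delta>'', 0])"
          "tracks M (p, \<alpha> @ \<delta>) [] (w @ [a] \<in> pda_language M) s' \<delta>''"
          "reaches (pda_step M) (pda_start M) (w @ [a]) (r, \<eta> @ \<delta>'')"
        unfolding lang step' by auto
      have "timestep (stack_machine M) (w @ [a]) (s', [stack_code \<delta>'', 0])"
        by (rule read[OF _ s'(1,2)]) (simp add: 1(1) Some e)
      moreover have "tracks M (pda_start M) (w @ [a]) (w @ [a] \<in> pda_language M) s' \<delta>''"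
        using s'(2) by (simp add: tracks_def step')
      ultimately show ?thesis
        using s'(3) by blast
    qed
  next
    case (2 f)
    show ?thesis
    proof (rule dead)
      fix c
      show "\<not> reaches (pda_step M) (pda_start M) (w @ [a]) c"
        unfolding reaches_snoc_iff using 2(2) settled_if_read by (metis list.exhaust surj_pair)
    qed (simp add: 2(1))
  qed
qed


section \<open>The growth of the stack\<close>

text \<open>\<open>Sup\<close> on \<open>nat\<close> is an upper bound only for a bounded set; here
  the set is finite because the transition table is.\<close>

lemma length_pda_trans_le:
  fixes M :: "('q::finite, 'a::finite, 'g::finite) dpda"
  assumes "pda_trans M q x X = Some (p, \<alpha>)"
  shows "length \<alpha> - 1 \<le> max_added M"
  unfolding max_added_def
proof (rule cSup_upper)
  have "{length \<alpha> - 1 | q x X p \<alpha>. pda_trans M q x X = Some (p, \<alpha>)}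
      \<subseteq> (\<lambda>(p, \<alpha>). length \<alpha> - 1) ` {e. \<exists>q x X. pda_trans M q x X = Some e}"
    by force
  then have "finite {length \<alpha> - 1 | q x X p \<alpha>. pda_trans M q x X = Some (p, \<alpha>)}"
    by (rule finite_subset) (intro finite_imageI finite_pda_trans)
  then show "bdd_above {length \<alpha> - 1 | q x X p \<alpha>. pda_trans M q x X = Some (p, \<alpha>)}"
    by simp
qed (use assms in blast)

lemma pda_step_length_le:
  fixes M :: "('q::finite, 'a::finite, 'g::finite) dpda"
  assumes "pda_step M (q, \<gamma>) x = Some (p, \<delta>)"
  shows "length \<delta> \<le> length \<gamma> + max_added M * pushing M (q, \<gamma>) x"
proof (cases \<gamma>)
  case (Cons X \<gamma>')
  with assms obtain \<alpha> where \<alpha>: "pda_trans M q x X = Some (p, \<alpha>)" "\<delta> = \<alpha> @ \<gamma>'"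
    by auto
  with length_pda_trans_le[OF \<alpha>(1)] show ?thesis
    by (auto simp: Cons)
qed (use assms in simp)

text \<open>With \<open>pushing\<close> as the weight, \<open>k\<close> counts the transitions that
  raise the stack, each by at most \<open>max_added M\<close>.\<close>

lemma run_pushing_length_le:
  fixes M :: "('q::finite, 'a::finite, 'g::finite) dpda"
  assumes "run (pda_step M) (pushing M) c w k d"
  shows "length (snd d) \<le> length (snd c) + max_added M * k"
  using assms
proof (induction rule: run.induct)
  case (run_refl c)
  then show ?case by simp
next
  case (run_eps c c' w k d)
  then show ?case
    using pda_step_length_le[of M "fst c" "snd c" None "fst c'" "snd c'"]
    by (simp add: distrib_left)
next
  case (run_read c a c' w k d)
  then show ?case
    using pda_step_length_le[of M "fst c" "snd c" "Some a" "fst c'" "snd c'"]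
    by (simp add: distrib_left)
qed

lemma pushing_le_1: "pushing M c x \<le> 1"
  by (cases c, cases "snd c") (auto split: option.split)

text \<open>The bottom symbol gives 1, the initial epsilon-sequence at most \<open>m * e\<close>,
  and each input symbol at most \<open>m\<close> for the reading step plus \<open>m * e\<close> for
  the epsilon-sequence after it.\<close>

lemma reaches_pda_length_le:
  fixes M :: "('q::finite, 'a::finite, 'g::finite) dpda"
  assumes fin: "finite (eps_push_counts M)"
    and "reaches (pda_step M) (pda_start M) w c"
  defines "m \<equiv> max_added M" and "e \<equiv> Max (eps_push_counts M)"
  shows "length (snd c) \<le> 1 + m * e + length w * m * (e + 1)"
  using assms(2)
proof (induction w arbitrary: c rule: rev_induct)
  \<comment> \<open>The push count of any epsilon-run from a reachable configuration belongs to
    \<open>eps_push_counts M\<close>, so it is at most \<open>e\<close>.\<close>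
  have eps: "length (snd d) \<le> length (snd c) + m * e"
    if "reaches (pda_step M) (pda_start M) w c" "reaches (pda_step M) c [] d" for w c d
  proof -
    from that(2) obtain k where k: "run (pda_step M) (pushing M) c [] k d"
      using reaches_iff_run by metis
    with that(1) have "k \<in> eps_push_counts M"
      unfolding eps_push_counts_def by blast
    then have "k \<le> e"
      unfolding e_def using fin by simp
    then have "m * k \<le> m * e"
      by simp
    with run_pushing_length_le[OF k] show ?thesis
      unfolding m_def by linarith
  qed
  {
    case Nil
    with eps[of "[]" "pda_start M" c] show ?case
      by (simp add: pda_start_def)
  next
    case (snoc a w)
    then obtain c1 c2 where c: "reaches (pda_step M) (pda_start M) w c1"
        "pda_step M c1 (Some a) = Some c2" "reaches (pda_step M) c2 [] c"
      unfolding reaches_snoc_iff by blast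
    have "length (snd c2) \<le> length (snd c1) + m * pushing M c1 (Some a)"
      using pda_step_length_le[of M "fst c1" "snd c1" "Some a" "fst c2" "snd c2"] c(2) by (simp add: m_def)
    also have "\<dots> \<le> length (snd c1) + m"
      using mult_le_mono2[OF pushing_le_1[of M c1 "Some a"], of m] by simp
    finally have c2: "length (snd c2) \<le> length (snd c1) + m" .
    have "reaches (pda_step M) c1 [a] c2"
      using c(2) by (rule reaches_read) simp
    with c(1) have "reaches (pda_step M) (pda_start M) (w @ [a]) c2"
      by (rule reaches_append)
    then have "length (snd c) \<le> length (snd c2) + m * e"
      using c(3) by (rule eps)
    moreover have "length (w @ [a]) * m * (e + 1) = length w * m * (e + 1) + m + m * e"
      by (simp add: algebra_simps)
    ultimately show ?case
      using c2 snoc.IH[OF c(1)] by linarith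
  }
qed

text \<open>A geometric sum with ratio at least 2 costs one extra factor. Over a single symbol there
  are \<open>h + 1\<close> such lists, while the power stays 1.\<close>

lemma card_lists_length_le_power:
  assumes "CARD('g::finite) \<ge> 2"
  shows "card {\<gamma> :: 'g list. length \<gamma> \<le> h} \<le> CARD('g) ^ Suc h"
proof -
  have "(\<Sum>i\<le>h. CARD('g) ^ i) \<le> CARD('g) ^ Suc h"
  proof (induction h)
    case (Suc h)
    have "(\<Sum>i\<le>Suc h. CARD('g) ^ i) \<le> 2 * CARD('g) ^ Suc h"
      using Suc by simp
    also have "\<dots> \<le> CARD('g) ^ Suc (Suc h)"
      using assms by simp
    finally show ?case .
  qed (use assms in simp)
  then show ?thesis
    using card_lists_length_le[of "UNIV :: 'g set" h] by simp
qed

text \<open>Timestep counters are codes of stacks of bounded height. The first factor is free of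
  \<open>n\<close>: its exponent collects the bottom symbol, the initial epsilon-sequence and the
  factor lost in the geometric sum.\<close>

lemma card_counter_configs_stack_machine_le:
  fixes M :: "('q::finite, 'a::finite, 'g::finite) dpda"
  assumes "is_dpda M" "finite (eps_push_counts M)" "CARD('g) \<ge> 2"
  defines "m \<equiv> max_added M" and "e \<equiv> Max (eps_push_counts M)"
  shows "card (counter_configs (stack_machine M) n) \<le> CARD('g) ^ (2 + m * e) * CARD('g) ^ (n * m * (e + 1))"
proof -
  let ?h = "1 + m * e + n * m * (e + 1)"
  let ?S = "{\<gamma> :: 'g list. length \<gamma> \<le> ?h}"
  have "counter_configs (stack_machine M) n \<subseteq> (\<lambda>\<gamma>. [stack_code \<gamma>, 0]) ` ?S"
  proof
    fix cs assume "cs \<in> counter_configs (stack_machine M) n"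
    then obtain w s where w: "length w \<le> n" "timestep (stack_machine M) w (s, cs)"
      by (auto simp: counter_configs_def)
    from timestep_stack_machine[OF assms(1), of w] obtain s' \<delta> w' q \<delta>' where
      s': "timestep (stack_machine M) w (s', [stack_code \<delta>, 0])"
      and w': "length w' \<le> length w" "reaches (pda_step M) (pda_start M) w' (q, \<delta>' @ \<delta>)"
      by blast
    have "cs = [stack_code \<delta>, 0]"
      using w(2) s' reaches_settled_unique[OF deterministic_stack_machine] unfolding timestep_def by blast
    moreover have "length \<delta> \<le> 1 + m * e + length w' * m * (e + 1)"
      using reaches_pda_length_le[OF assms(2) w'(2)] by (simp add: m_def e_def)
    moreover have "length w' * m * (e + 1) \<le> n * m * (e + 1)"
      using w(1) w'(1) by (intro mult_le_mono1) simp
    ultimately show "cs \<in> (\<lambda>\<gamma>. [stack_code \<gamma>, 0]) ` ?S"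
      by simp
  qed
  moreover have "finite ?S"
    using finite_lists_length_le[of "UNIV :: 'g set"] by simp
  ultimately have "card (counter_configs (stack_machine M) n) \<le> card ?S"
    by (rule surj_card_le[rotated])
  also have "\<dots> \<le> CARD('g) ^ Suc ?h"
    by (rule card_lists_length_le_power[OF assms(3)])
  also have "\<dots> = CARD('g) ^ (2 + m * e) * CARD('g) ^ (n * m * (e + 1))"
    by (simp flip: power_add)
  finally show ?thesis .
qed

theorem theorem3:
  fixes M :: "('q::finite, 'a::finite, 'g::finite) dpda"
    and L :: "'a list set"
  assumes "is_dpda M" and "pda_language M = L"
  shows "\<exists>A :: (nat, 'a) cra.
    is_counter_machine A \<and> encodes A L \<and>
    (finite (eps_push_counts M) \<and> CARD('g) \<ge> 2 \<longrightarrow>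
      (\<lambda>n. real (card (counter_configs A n)))
        \<in> O(\<lambda>n. real CARD('g) ^ (n * max_added M * (Max (eps_push_counts M) + 1))))"
proof (intro exI conjI impI)
  let ?A = "nat_cra (stack_machine M)"
  show "is_counter_machine ?A"
    by (intro is_counter_machine_nat_cra is_counter_machine_stack_machine)
  show "encodes ?A L"
  proof (rule encodes_nat_cra[OF deterministic_stack_machine])
    fix q z
    assume "q \<in> cm_final (stack_machine M)"
    then show "cm_trans (stack_machine M) q None z = None"
      by (auto simp: stack_machine_def)
  next
    fix w
    obtain s \<delta> where "timestep (stack_machine M) w (s, [stack_code \<delta>, 0])"
        "tracks M (pda_start M) w (w \<in> L) s \<delta>"
      using timestep_stack_machine[OF assms(1), of w] assms(2) by blast
    then show "\<exists>c. timestep (stack_machine M) w c \<and> (fst c \<in> cm_final (stack_machine M) \<longleftrightarrow> w \<in> L)"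
      by (intro exI[of _ "(s, [stack_code \<delta>, 0])"]) (auto simp: tracks_def stack_machine_def)
  qed
  assume "finite (eps_push_counts M) \<and> CARD('g) \<ge> 2"
  then show "(\<lambda>n. real (card (counter_configs ?A n)))
      \<in> O(\<lambda>n. real CARD('g) ^ (n * max_added M * (Max (eps_push_counts M) + 1)))"
    using card_counter_configs_stack_machine_le[OF assms(1)]
    by (intro bigoI[of _ "real CARD('g) ^ (2 + max_added M * Max (eps_push_counts M))"] always_eventually allI)
      (simp add: counter_configs_nat_cra flip: of_nat_power of_nat_mult)
qed

end
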